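(* Let $(G,G_1,G_2)$ be a quasi-double Lie group with structure maps $\alpha$ and $m$, and let $\sigma:G_2\times G_1\to G_2$ be defined by: for $a\in G_2$, $g\in G_1$, $\sigma(a,g)$ is the unique element of $G_2$ such that $ag=g'\,\sigma(a,g)$ in $G$ for some $g'\in G_1$. For $a\in G_2$ let $\lambda_a,\rho_a:G_2\to G_2$ be the left and right translations of the loop, $\lambda_a(c)=m(a,c)$, $\rho_a(c)=m(c,a)$. Then for all $a,b,c\in G_2$: \begin{enumerate} \item $\lambda_{m(a,b)}(c)=(\lambda_{\sigma(a,\alpha(b,c))}\circ\lambda_b)(c)$; \item $\rho_{m(a,b)}(c)=(\rho_b\circ\rho_a)(\sigma(c,\alpha(a,b)^{-1}))$; \item $(\rho_b\circ\lambda_a)(c)=(\lambda_{\sigma(a,\alpha(c,b))}\circ\rho_b)(c)$. \end{enumerate}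
   Context: A Lie loop is a real analytic manifold $B$ with an analytic binary operation $(a,b)\mapsto ab=m(a,b)$ having a two-sided neutral element $\varepsilon$, such that the equations $ab=c$ and $ba=c$ have unique solutions depending analytically on the data. It is right mono-alternative if $(ab^{k})b^{l}=ab^{k+l}$ for all integers $k,l$ and all $a,b$ (near $\varepsilon$). A quasi-double Lie group is a triple $(G,G_1,G_2)$ where (i) $G$ is a Lie group with identity $e$ and $G_1$ a closed Lie subgroup of $G$; (ii) $G_2$ is a closed submanifold of $G$ equipped with analytic maps $\alpha:G_2\times G_2\to G_1$ and $m:G_2\times G_2\to G_2$ with $(ab)_G=\alpha(a,b)\,m(a,b)$ for all $a,b\in G_2$ (product in $G$ on the left), such that $m$ makes $G_2$ a right mono-alternative Lie loop; (iii) the map $G_1\times G_2\to G$, $(g,a)\mapsto ga$, is a diffeomorphism. *)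

theory Defs
  imports "HOL-Algebra.Group"
begin

definition loop_inv :: "'a set \<Rightarrow> ('a \<Rightarrow> 'a \<Rightarrow> 'a) \<Rightarrow> 'a \<Rightarrow> 'a \<Rightarrow> 'a" where
  "loop_inv B m eps b = (THE x. x \<in> B \<and> m b x = eps)"

definition loop_pow :: "'a set \<Rightarrow> ('a \<Rightarrow> 'a \<Rightarrow> 'a) \<Rightarrow> 'a \<Rightarrow> 'a \<Rightarrow> int \<Rightarrow> 'a" where
  "loop_pow B m eps b k =
     (if 0 \<le> k then ((\<lambda>x. m x b) ^^ nat k) eps
      else ((\<lambda>x. m x (loop_inv B m eps b)) ^^ nat (- k)) eps)"

definition is_loop :: "'a set \<Rightarrow> ('a \<Rightarrow> 'a \<Rightarrow> 'a) \<Rightarrow> 'a \<Rightarrow> bool" where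
  "is_loop B m eps \<longleftrightarrow>
     eps \<in> B \<and> (\<forall>a\<in>B. \<forall>b\<in>B. m a b \<in> B) \<and>
     (\<forall>a\<in>B. m eps a = a \<and> m a eps = a) \<and>
     (\<forall>a\<in>B. \<forall>c\<in>B. (\<exists>!b. b \<in> B \<and> m a b = c) \<and> (\<exists>!b. b \<in> B \<and> m b a = c))"

definition right_mono_alternative :: "'a set \<Rightarrow> ('a \<Rightarrow> 'a \<Rightarrow> 'a) \<Rightarrow> 'a \<Rightarrow> bool" where
  "right_mono_alternative B m eps \<longleftrightarrow>
     (\<forall>a\<in>B. \<forall>b\<in>B. \<forall>k l :: int.
        m (m a (loop_pow B m eps b k)) (loop_pow B m eps b l) = m a (loop_pow B m eps b (k + l)))"

text \<open>Algebraic core of a quasi-double Lie group (G, G1, G2) with structure maps alpha, m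
  and loop neutral element eps.\<close>
definition quasi_double_group ::
  "('a, 'b) monoid_scheme \<Rightarrow> 'a set \<Rightarrow> 'a set \<Rightarrow> ('a \<Rightarrow> 'a \<Rightarrow> 'a) \<Rightarrow> ('a \<Rightarrow> 'a \<Rightarrow> 'a) \<Rightarrow> 'a \<Rightarrow> bool"
where
  "quasi_double_group G G1 G2 \<alpha> m eps \<longleftrightarrow>
     group G \<and> subgroup G1 G \<and> G2 \<subseteq> carrier G \<and>
     (\<forall>a\<in>G2. \<forall>b\<in>G2. \<alpha> a b \<in> G1 \<and> m a b \<in> G2 \<and> a \<otimes>\<^bsub>G\<^esub> b = \<alpha> a b \<otimes>\<^bsub>G\<^esub> m a b) \<and>
     is_loop G2 m eps \<and> right_mono_alternative G2 m eps \<and>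
     bij_betw (\<lambda>(g, a). g \<otimes>\<^bsub>G\<^esub> a) (G1 \<times> G2) (carrier G)"

definition qd_sigma :: "('a, 'b) monoid_scheme \<Rightarrow> 'a set \<Rightarrow> 'a set \<Rightarrow> 'a \<Rightarrow> 'a \<Rightarrow> 'a" where
  "qd_sigma G G1 G2 a g = (THE c. c \<in> G2 \<and> (\<exists>g'\<in>G1. a \<otimes>\<^bsub>G\<^esub> g = g' \<otimes>\<^bsub>G\<^esub> c))"

end

theory Submission
  imports Defs
begin

text \<open>Since \<open>G = G1 G2\<close> with unique factorization, every element \<open>x\<close> of \<open>G\<close> has a well-defined
  \<open>G2\<close>-component, which only depends on the right coset \<open>G1 x\<close>. The loop product is
  \<open>m a b = [a b]\<close> and \<open>\<sigma> a g = [a g]\<close>, where \<open>[x]\<close> denotes this component, and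
  \<open>[[x] y] = [x y]\<close>. All three identities then follow by computing the component of a triple
  product in \<open>G\<close> in two ways, using associativity of \<open>G\<close>.\<close>

locale group_factorization = group G for G (structure) +
  fixes G1 G2 :: "'a set"
  assumes subgroup_G1: "subgroup G1 G"
    and G2_carrier: "G2 \<subseteq> carrier G"
    and factorization_bij: "bij_betw (\<lambda>(g, a). g \<otimes> a) (G1 \<times> G2) (carrier G)"
begin

definition right_factor :: "'a \<Rightarrow> 'a" where
  "right_factor x = (THE c. c \<in> G2 \<and> (\<exists>g\<in>G1. x = g \<otimes> c))"

lemma G1_carrier: "G1 \<subseteq> carrier G"
  using subgroup_G1 by (rule subgroup.subset)

lemma factorization_unique:
  assumes "g \<in> G1" "h \<in> G1" "x \<in> G2" "y \<in> G2" and "g \<otimes> x = h \<otimes> y"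
  shows "x = y"
proof -
  have "inj_on (\<lambda>(g, a). g \<otimes> a) (G1 \<times> G2)"
    using factorization_bij by (rule bij_betw_imp_inj_on)
  then have "(g, x) = (h, y)"
    by (rule inj_onD) (use assms in auto)
  then show ?thesis by simp
qed

lemma factorization_exists:
  assumes "x \<in> carrier G"
  obtains g c where "g \<in> G1" "c \<in> G2" "x = g \<otimes> c"
proof -
  obtain p where "p \<in> G1 \<times> G2" "x = (\<lambda>(g, a). g \<otimes> a) p"
    using assms factorization_bij unfolding bij_betw_def by blast
  with that show ?thesis by auto
qed

lemma right_factor_eq:
  assumes "g \<in> G1" "c \<in> G2" "x = g \<otimes> c"
  shows "right_factor x = c"
  unfolding right_factor_def
proof (rule the_equality)
  show "c \<in> G2 \<and> (\<exists>g\<in>G1. x = g \<otimes> c)" using assms by blast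
next
  fix d assume "d \<in> G2 \<and> (\<exists>h\<in>G1. x = h \<otimes> d)"
  then show "d = c" using assms factorization_unique by metis
qed

lemma right_factor_closed: "x \<in> carrier G \<Longrightarrow> right_factor x \<in> G2"
  by (metis factorization_exists right_factor_eq)

lemma right_factor_mult_G1:
  assumes "h \<in> G1" "x \<in> carrier G"
  shows "right_factor (h \<otimes> x) = right_factor x"
proof -
  obtain g c where g: "g \<in> G1" "c \<in> G2" "x = g \<otimes> c"
    using assms(2) by (rule factorization_exists)
  have "h \<otimes> x = (h \<otimes> g) \<otimes> c"
    using g assms(1) G1_carrier G2_carrier by (simp add: m_assoc subset_iff)
  moreover have "h \<otimes> g \<in> G1"
    using subgroup_G1 assms(1) g(1) by (rule subgroup.m_closed)
  ultimately show ?thesis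
    using g by (simp add: right_factor_eq)
qed

lemma right_factor_mult:
  assumes "x \<in> carrier G" "y \<in> carrier G"
  shows "right_factor (right_factor x \<otimes> y) = right_factor (x \<otimes> y)"
proof -
  obtain g c where g: "g \<in> G1" "c \<in> G2" "x = g \<otimes> c"
    using assms(1) by (rule factorization_exists)
  then have "right_factor x = c"
    by (rule right_factor_eq)
  moreover have "x \<otimes> y = g \<otimes> (c \<otimes> y)"
    using g assms(2) G1_carrier G2_carrier by (simp add: m_assoc subset_iff)
  ultimately show ?thesis
    using g assms G2_carrier by (auto simp: right_factor_mult_G1)
qed

lemma qd_sigma_eq_right_factor: "qd_sigma G G1 G2 a g = right_factor (a \<otimes> g)"
  by (simp add: qd_sigma_def right_factor_def)

end

lemma quasi_double_group_factorization:
  "quasi_double_group G G1 G2 \<alpha> m eps \<Longrightarrow> group_factorization G G1 G2"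
  unfolding quasi_double_group_def group_factorization_def group_factorization_axioms_def
  by blast

lemma quasi_double_product_eq_right_factor:
  assumes qd: "quasi_double_group G G1 G2 \<alpha> m eps" and "a \<in> G2" "b \<in> G2"
  shows "m a b = group_factorization.right_factor G G1 G2 (a \<otimes>\<^bsub>G\<^esub> b)"
proof -
  interpret group_factorization G G1 G2
    using qd by (rule quasi_double_group_factorization)
  show ?thesis
    using qd assms(2,3) unfolding quasi_double_group_def by (metis right_factor_eq)
qed

lemma quasi_double_twisted_assoc_left:
  fixes G (structure)
  assumes qd: "quasi_double_group G G1 G2 \<alpha> m eps"
    and a: "a \<in> G2" and b: "b \<in> G2" and c: "c \<in> G2"
  shows "m (m a b) c = m (qd_sigma G G1 G2 a (\<alpha> b c)) (m b c)"
proof -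
  interpret group_factorization G G1 G2
    using qd by (rule quasi_double_group_factorization)
  note prod = quasi_double_product_eq_right_factor[OF qd]
  have bc: "\<alpha> b c \<in> G1" "m b c \<in> G2" "b \<otimes> c = \<alpha> b c \<otimes> m b c"
    using qd b c unfolding quasi_double_group_def by auto
  have carr: "a \<in> carrier G" "b \<in> carrier G" "c \<in> carrier G" "m b c \<in> carrier G"
    "\<alpha> b c \<in> carrier G"
    using a b c bc G1_carrier G2_carrier by auto
  have "m (m a b) c = right_factor (right_factor (a \<otimes> b) \<otimes> c)"
    using a b c carr by (simp add: prod right_factor_closed)
  also have "\<dots> = right_factor (a \<otimes> (\<alpha> b c \<otimes> m b c))"
    using carr by (simp add: right_factor_mult m_assoc flip: bc(3))
  also have "\<dots> = right_factor (right_factor (a \<otimes> \<alpha> b c) \<otimes> m b c)"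
    using carr by (simp add: right_factor_mult m_assoc)
  also have "\<dots> = m (qd_sigma G G1 G2 a (\<alpha> b c)) (m b c)"
    using carr bc by (simp add: prod qd_sigma_eq_right_factor right_factor_closed)
  finally show ?thesis .
qed

lemma quasi_double_twisted_assoc_right:
  fixes G (structure)
  assumes qd: "quasi_double_group G G1 G2 \<alpha> m eps"
    and a: "a \<in> G2" and b: "b \<in> G2" and c: "c \<in> G2"
  shows "m c (m a b) = m (m (qd_sigma G G1 G2 c (inv (\<alpha> a b))) a) b"
proof -
  interpret group_factorization G G1 G2
    using qd by (rule quasi_double_group_factorization)
  note prod = quasi_double_product_eq_right_factor[OF qd]
  define s where "s = qd_sigma G G1 G2 c (inv (\<alpha> a b))"
  have ab: "\<alpha> a b \<in> G1" "m a b \<in> G2" "a \<otimes> b = \<alpha> a b \<otimes> m a b"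
    using qd a b unfolding quasi_double_group_def by auto
  have carr: "a \<in> carrier G" "b \<in> carrier G" "c \<in> carrier G" "m a b \<in> carrier G"
    "\<alpha> a b \<in> carrier G"
    using a b c ab G1_carrier G2_carrier by auto
  have s: "s = right_factor (c \<otimes> inv (\<alpha> a b))" "s \<in> G2"
    using carr by (simp_all add: s_def qd_sigma_eq_right_factor right_factor_closed)
  have "m a b = inv (\<alpha> a b) \<otimes> (a \<otimes> b)"
    using carr by (simp add: ab(3) m_assoc[symmetric])
  then have "m c (m a b) = right_factor ((c \<otimes> inv (\<alpha> a b)) \<otimes> a \<otimes> b)"
    using c ab(2) carr by (simp add: prod m_assoc)
  also have "\<dots> = right_factor (right_factor (s \<otimes> a) \<otimes> b)"
    using carr s by (simp add: right_factor_mult)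
  also have "\<dots> = m (m s a) b"
    using a b s(2) carr G2_carrier by (auto simp: prod right_factor_closed)
  finally show ?thesis unfolding s_def .
qed

theorem mainTheorem2:
  fixes G :: "('a, 'b) monoid_scheme"
    and G1 G2 :: "'a set"
    and \<alpha> m :: "'a \<Rightarrow> 'a \<Rightarrow> 'a"
    and eps :: 'a
  assumes qd: "quasi_double_group G G1 G2 \<alpha> m eps"
    and a: "a \<in> G2" and b: "b \<in> G2" and c: "c \<in> G2"
  defines "\<sigma> \<equiv> qd_sigma G G1 G2"
  shows "m (m a b) c = m (\<sigma> a (\<alpha> b c)) (m b c) \<and>
         m c (m a b) = m (m (\<sigma> c (inv\<^bsub>G\<^esub> (\<alpha> a b))) a) b \<and>
         m (m a c) b = m (\<sigma> a (\<alpha> c b)) (m c b)"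
  unfolding \<sigma>_def
  using quasi_double_twisted_assoc_left[OF qd a b c]
    quasi_double_twisted_assoc_right[OF qd a b c]
    quasi_double_twisted_assoc_left[OF qd a c b]
  by blast

end
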